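(* Let $S$ be a linear subspace of $\mathbb{R}^n$ with dimension $D$. Let $\xi=(\xi_1,\dots,\xi_n)$ be a random vector with independent centered components such that, for some nonnegative numbers $\sigma$ and $c$, $$\log\mathbb{E}\left[e^{\lambda\xi_i}\right]\le\frac{\lambda^2\sigma^2}{2(1-|\lambda|c)}\qquad\text{for all }\lambda\in(-1/c,1/c)\text{ and }i=1,\dots,n$$ (with the convention $1/0=+\infty$). Then for all $x,u>0$, $$\mathbb{P}\left[|\Pi_S\xi|_2^2\ge\kappa^2\left(\sigma^2+\frac{2cu}{\kappa}\right)(D+x),\ |\Pi_S\xi|_\infty\le u\right]\le e^{-x}$$ with $\kappa=18$, and $$\mathbb{P}\left(|\Pi_S\xi|_\infty\ge x\right)\le 2n\exp\left[-\frac{x^2}{2\Lambda_2^2(S)(\sigma^2+cx)}\right],$$ where $\Lambda_2(S)=\max_{i=1,\dots,n}|\Pi_Se_i|_2$.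
   Context: Throughout $n\ge2$. $e_1,\dots,e_n$ is the canonical basis of $\mathbb{R}^n$, $|\cdot|_2$ is the Euclidean norm, $|x|_\infty=\max_{i}|x_i|$, and $\Pi_S$ is the orthogonal projector onto $S$. $\Lambda_2^2(S)$ denotes $(\Lambda_2(S))^2$.
   Formalization: The first inequality is stated only when σ and c are not both zero: if σ = c = 0 then ξ = 0 almost surely, the threshold is 0, and the event has probability 1 > e^{-x}, so the claim fails. In the second, exp[-x²/0] is read as 0. *)

theory Defs
  imports "HOL-Probability.Probability"
begin

definition orth_proj :: "'a::euclidean_space set \<Rightarrow> 'a \<Rightarrow> 'a" where
  "orth_proj S x = (THE p. p \<in> S \<and> (\<forall>y\<in>S. orthogonal (x - p) y))"

lemma orth_proj_ex1:
  fixes S :: "'a::euclidean_space set"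
  assumes "subspace S"
  shows "\<exists>!p. p \<in> S \<and> (\<forall>y\<in>S. orthogonal (x - p) y)"
proof (rule ex_ex1I)
  obtain y z where "y \<in> span S" and z: "\<And>w. w \<in> span S \<Longrightarrow> orthogonal z w" and x: "x = y + z"
    using orthogonal_subspace_decomp_exists[of S x] by blast
  moreover have "span S = S"
    using assms by (simp add: span_eq_iff)
  ultimately show "\<exists>p. p \<in> S \<and> (\<forall>y\<in>S. orthogonal (x - p) y)"
    by (intro exI[of _ y]) auto
next
  fix p q
  assume p: "p \<in> S \<and> (\<forall>y\<in>S. orthogonal (x - p) y)"
    and q: "q \<in> S \<and> (\<forall>y\<in>S. orthogonal (x - q) y)"
  have "p - q \<in> S"
    using p q assms by (simp add: subspace_diff)
  then have "(x - p) \<bullet> (p - q) = 0" "(x - q) \<bullet> (p - q) = 0"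
    using p q by (simp_all add: orthogonal_def)
  then have "(p - q) \<bullet> (p - q) = 0"
    by (simp add: inner_diff_left)
  then show "p = q" by simp
qed

lemma orth_proj:
  fixes S :: "'a::euclidean_space set"
  assumes "subspace S"
  shows orth_proj_in: "orth_proj S x \<in> S"
    and orth_proj_orthogonal: "y \<in> S \<Longrightarrow> orthogonal (x - orth_proj S x) y"
  using theI'[OF orth_proj_ex1[OF assms, of x]] unfolding orth_proj_def by blast+

definition Lambda2 :: "(real ^ 'n) set \<Rightarrow> real" where
  "Lambda2 S = Max (range (\<lambda>i::'n. norm (orth_proj S (axis i 1))))"

text \<open>
  The value of \<open>exp (- a / b)\<close> for \<open>a > 0\<close> and \<open>b \<ge> 0\<close>, with the usual conventions
  \<open>a / 0 = \<infinity>\<close> and \<open>exp (- \<infinity>) = 0\<close>. With the total division of HOL the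
  expression would be \<open>1\<close> for \<open>b = 0\<close>, which would make a tail bound vacuous.
\<close>
definition exp_neg_div :: "real \<Rightarrow> real \<Rightarrow> real" where
  "exp_neg_div a b = (if b = 0 then 0 else exp (- (a / b)))"

end

theory Submission
  imports Defs
begin

text \<open>
  Both bounds rest on one fact: for a fixed \<open>t\<close> the linear form \<open>t \<bullet> \<xi>\<close> of independent
  components satisfying the Bernstein moment condition satisfies it again, with variance factor
  \<open>\<bar>t\<bar>\<^sub>2\<^sup>2 \<sigma>\<^sup>2\<close> and scale \<open>\<bar>t\<bar>\<^sub>\<infinity> c\<close> (lemma \<open>sub_gamma_inner\<close>).

  The bound on the sup norm is Bernstein's inequality for the coordinates of the projection and a
  union bound over coordinates and signs. Coordinate \<open>i\<close> is \<open>t \<bullet> \<xi>\<close> with \<open>t = \<Pi>\<^sub>S e\<^sub>i\<close>. Here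
  \<open>\<bar>t\<bar>\<^sub>2 \<le> \<Lambda>\<^sub>2(S)\<close>, and the entries are \<open>t\<^sub>j = \<Pi>\<^sub>S e\<^sub>i \<bullet> \<Pi>\<^sub>S e\<^sub>j\<close>, so \<open>\<bar>t\<bar>\<^sub>\<infinity> \<le> \<Lambda>\<^sub>2(S)\<^sup>2\<close>;
  this is why the factor \<open>\<Lambda>\<^sub>2(S)\<^sup>2\<close> multiplies both terms of the denominator.

  The bound on the Euclidean norm comes from averaging exponentials over a convex body. Let \<open>K\<close> be the set of \<open>t \<in> S\<close> with \<open>\<bar>t\<bar>\<^sub>2 \<le> r\<close> and \<open>\<bar>t\<bar>\<^sub>\<infinity> \<le> b\<close>. With
  suitable \<open>r\<close> and \<open>b\<close> the exponential moment of \<open>t \<bullet> \<xi>\<close> is at most \<open>exp (D + x)\<close> for every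
  \<open>t \<in> K\<close>, hence so is the expectation of the average of \<open>exp (t \<bullet> \<xi>)\<close> over \<open>K\<close>. On the event in
  question, the point \<open>t\<^sub>0 = r \<Pi>\<^sub>S\<xi> / (4 \<bar>\<Pi>\<^sub>S\<xi>\<bar>\<^sub>2)\<close> lies deep inside \<open>K\<close>: the bound on the sup norm
  gives \<open>\<bar>t\<^sub>0\<bar>\<^sub>\<infinity> \<le> b / 4\<close>. So \<open>t\<^sub>0 + K / 2\<close> is contained in \<open>K\<close>, and since \<open>K / 2\<close> is symmetric,
  Jensen's inequality shows that averaging \<open>exp (t \<bullet> \<xi>)\<close> over \<open>t\<^sub>0 + K / 2\<close> gives at least
  \<open>exp (t\<^sub>0 \<bullet> \<xi>)\<close>. Passing from \<open>t\<^sub>0 + K / 2\<close> to \<open>K\<close> costs only a factor exponential in \<open>D\<close>, which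
  \<open>exp (t\<^sub>0 \<bullet> \<xi>) = exp (r \<bar>\<Pi>\<^sub>S\<xi>\<bar>\<^sub>2 / 4)\<close> outweighs. Markov's inequality concludes.

  The average is taken over the points of a fine lattice of \<open>S\<close> that lie in \<open>K\<close>. Then it is a
  finite sum, and the comparison of \<open>K\<close> with \<open>K / 2\<close> is a count of residues modulo 4
  (lemmas \<open>card_lattice_le_card_dilate\<close> and \<open>exp_inner_le_lattice_average\<close>).
\<close>

section \<open>Exponential averages over symmetric convex bodies\<close>

text \<open>
  Two points of \<open>A\<close> that agree modulo \<open>m\<close> differ by \<open>m\<close> times a point of \<open>H\<close>. So subtracting a
  base point and dividing by \<open>m\<close> maps each residue class of \<open>A\<close> injectively into \<open>H\<close>. There are \<open>m ^ card B\<close> residue classes. If \<open>A\<close>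
  holds the lattice points of a symmetric convex body \<open>K\<close>, then the set of lattice points of
  \<open>(2 / m) K\<close> can serve as \<open>H\<close>, and the lemma replaces a comparison of volumes.
\<close>

lemma card_lattice_le_card_dilate:
  fixes A H :: "('a \<Rightarrow> int) set" and m :: nat
  assumes B: "finite B" and A: "finite A" and H: "finite H" and m: "m > 0"
    and supp: "\<And>k x. k \<in> A \<Longrightarrow> x \<notin> B \<Longrightarrow> k x = 0"
    and quot: "\<And>k k' j. k \<in> A \<Longrightarrow> k' \<in> A \<Longrightarrow> (\<And>x. k x - k' x = int m * j x) \<Longrightarrow> j \<in> H"
  shows "card A \<le> m ^ card B * card H"
proof -
  define res where "res k = restrict (\<lambda>x. k x mod int m) B" for k :: "'a \<Rightarrow> int"
  define R where "R = (B \<rightarrow>\<^sub>E {0..<int m})"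
  have finR: "finite R" and cardR: "card R = m ^ card B"
    using B by (auto simp: R_def card_PiE intro: finite_PiE)
  have res_in: "res k \<in> R" for k
    using m by (auto simp: res_def R_def)
  have fibre: "card {k \<in> A. res k = \<rho>} \<le> card H" for \<rho>
  proof (cases "\<exists>k\<^sub>0\<in>A. res k\<^sub>0 = \<rho>")
    case True
    then obtain k\<^sub>0 where k0: "k\<^sub>0 \<in> A" "res k\<^sub>0 = \<rho>" by blast
    define q where "q k = (\<lambda>x. (k x - k\<^sub>0 x) div int m)" for k :: "'a \<Rightarrow> int"
    have split: "k x - k\<^sub>0 x = int m * q k x" if "k \<in> A" "res k = \<rho>" for k x
    proof (cases "x \<in> B")
      case True
      then have "k x mod int m = k\<^sub>0 x mod int m"
        using that k0 by (metis res_def restrict_apply')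
      then have "int m dvd k x - k\<^sub>0 x"
        by (simp add: mod_eq_dvd_iff)
      then show ?thesis by (simp add: q_def)
    next
      case False
      then have "k x = 0" "k\<^sub>0 x = 0" using supp that k0 by blast+
      then show ?thesis by (simp add: q_def)
    qed
    have "inj_on q {k \<in> A. res k = \<rho>}"
    proof (rule inj_onI)
      fix k k' assume k: "k \<in> {k \<in> A. res k = \<rho>}" "k' \<in> {k \<in> A. res k = \<rho>}" "q k = q k'"
      then have "k x - k\<^sub>0 x = k' x - k\<^sub>0 x" for x
        using split[of k x] split[of k' x] by simp
      then show "k = k'" by auto
    qed
    moreover have "q ` {k \<in> A. res k = \<rho>} \<subseteq> H"
      using quot split k0 by blast
    ultimately show ?thesis using H card_inj_on_le by blast
  next
    case False
    then have "{k \<in> A. res k = \<rho>} = {}" by blast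
    then show ?thesis by (metis card.empty zero_le)
  qed
  have "A = (\<Union>\<rho>\<in>R. {k \<in> A. res k = \<rho>})"
    using res_in by auto
  then have "card A \<le> (\<Sum>\<rho>\<in>R. card {k \<in> A. res k = \<rho>})"
    using card_UN_le[OF finR] by metis
  also have "\<dots> \<le> (\<Sum>\<rho>\<in>R. card H)"
    by (rule sum_mono) (rule fibre)
  finally show ?thesis by (simp add: cardR)
qed

text \<open>
  Jensen's inequality for the uniform distribution on \<open>H\<close>: \<open>f\<close> is odd under the bijection \<open>g\<close>, so
  its mean is 0, and \<open>1 + f s \<le> exp (f s)\<close>.
\<close>

lemma card_exp_le_sum_exp_symmetric:
  fixes f :: "'a \<Rightarrow> real"
  assumes H: "finite H" and bij: "bij_betw g H H" and odd: "\<And>s. s \<in> H \<Longrightarrow> f (g s) = - f s"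
  shows "real (card H) \<le> (\<Sum>s\<in>H. exp (f s))"
proof -
  have "(\<Sum>s\<in>H. f s) = (\<Sum>s\<in>H. f (g s))"
    using sum.reindex_bij_betw[OF bij, of f] by simp
  also have "\<dots> = - (\<Sum>s\<in>H. f s)"
    by (simp add: odd sum_negf)
  finally have "(\<Sum>s\<in>H. f s) = 0" by simp
  then have "real (card H) = (\<Sum>s\<in>H. 1 + f s)"
    by (simp add: sum.distrib)
  also have "\<dots> \<le> (\<Sum>s\<in>H. exp (f s))"
    by (rule sum_mono) (rule exp_ge_add_one_self)
  finally show ?thesis .
qed

text \<open>
  The sum over \<open>A\<close> is at least the sum over a translate of \<open>K / 2\<close> centred near \<open>t\<close>, which lies in
  \<open>K\<close> because \<open>t\<close> belongs to \<open>K / 4\<close>; the symmetry of \<open>K / 2\<close> bounds the latter sum from below by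
  its central term times its number of points. The factor \<open>4 ^ dim S\<close> bounds the ratio of the
  numbers of lattice points in \<open>K\<close> and \<open>K / 2\<close>, and \<open>\<epsilon>\<close> pays for rounding \<open>t\<close> to the lattice. The
  set \<open>A\<close> depends neither on \<open>t\<close> nor on \<open>z\<close>, so \<open>z\<close> may later be random and \<open>t\<close> may depend on it.
\<close>

lemma exp_inner_le_lattice_average:
  fixes S K :: "'a::euclidean_space set"
  assumes S: "subspace S" and KS: "K \<subseteq> S" and convex: "convex K" and bounded: "bounded K"
    and sym: "\<And>a. a \<in> K \<Longrightarrow> - a \<in> K"
    and ball: "\<delta> > 0" "\<And>a. a \<in> S \<Longrightarrow> norm a \<le> \<delta> \<Longrightarrow> a \<in> K"
    and \<epsilon>: "\<epsilon> > 0"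
  obtains A where "finite A" "A \<noteq> {}" "A \<subseteq> K"
    "\<And>t z. t \<in> S \<Longrightarrow> 4 *\<^sub>R t \<in> K \<Longrightarrow>
       real (card A) * exp (t \<bullet> z - \<epsilon> * norm z) \<le> 4 ^ dim S * (\<Sum>a\<in>A. exp (a \<bullet> z))"
proof -
  obtain B where BS: "B \<subseteq> S" and orth: "pairwise orthogonal B"
    and nrm: "\<And>b. b \<in> B \<Longrightarrow> norm b = 1" and "independent B"
    and cardB: "card B = dim S" and spanB: "span B = S"
    using orthonormal_basis_subspace[OF S] by blast
  then have finB: "finite B" using independent_imp_finite by blast
  have inner_basis: "b \<bullet> b' = (if b = b' then 1 else 0)" if "b \<in> B" "b' \<in> B" for b b'
    using that orth nrm by (auto simp: pairwise_def orthogonal_def dot_square_norm)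
  have coord: "(\<Sum>b\<in>B. f b *\<^sub>R b) \<bullet> b' = f b'" if "b' \<in> B" for f b'
    using that finB by (simp add: inner_sum_left inner_basis if_distrib cong: if_cong)
  have expand: "t = (\<Sum>b\<in>B. (t \<bullet> b) *\<^sub>R b)" if "t \<in> S" for t
  proof -
    have "t \<in> range (\<lambda>f. \<Sum>b\<in>B. f b *\<^sub>R b)"
      using that spanB span_finite[OF finB] by simp
    then obtain f where "t = (\<Sum>b\<in>B. f b *\<^sub>R b)" by (rule rangeE)
    then show ?thesis by (simp add: coord)
  qed
  \<comment> \<open>The mesh is so fine that rounding to the lattice moves a point by at most
     \<open>\<epsilon>\<close>, and four times the displacement stays in \<open>K\<close>.\<close>
  define h where "h = min \<epsilon> (\<delta> / 4) / (real (card B) + 1)"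
  have h: "h > 0" using \<epsilon> ball by (simp add: h_def)
  have mesh: "real (card B) * h \<le> min \<epsilon> (\<delta> / 4)"
  proof -
    have "real (card B) * h \<le> (real (card B) + 1) * h" using h by simp
    also have "\<dots> = min \<epsilon> (\<delta> / 4)" by (simp add: h_def)
    finally show ?thesis .
  qed
  \<comment> \<open>Lattice points are handled through their integer coordinates \<open>k\<close>, which vanish outside
     \<open>B\<close>.\<close>
  define \<phi> where "\<phi> k = (\<Sum>b\<in>B. (h * real_of_int (k b)) *\<^sub>R b)" for k :: "'a \<Rightarrow> int"
  have \<phi>_coord: "\<phi> k \<bullet> b = h * real_of_int (k b)" if "b \<in> B" for k b
    unfolding \<phi>_def using coord[OF that] .
  have \<phi>_S: "\<phi> k \<in> S" for k
    unfolding \<phi>_def using BS by (intro subspace_sum subspace_scale S) auto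
  have \<phi>_add: "\<phi> (\<lambda>x. k x + k' x) = \<phi> k + \<phi> k'" for k k'
    by (simp add: \<phi>_def sum.distrib[symmetric] scaleR_add_left[symmetric] distrib_left)
  have \<phi>_mult: "\<phi> (\<lambda>x. m * k x) = real_of_int m *\<^sub>R \<phi> k" for m k
    by (simp add: \<phi>_def scaleR_sum_right ac_simps)
  have \<phi>_minus: "\<phi> (\<lambda>x. - k x) = - \<phi> k" for k
    using \<phi>_mult[of "-1" k] by simp
  define Z where "Z = {k :: 'a \<Rightarrow> int. \<forall>x. x \<notin> B \<longrightarrow> k x = 0}"
  have inj_\<phi>: "inj_on \<phi> Z"
  proof (rule inj_onI)
    fix k k' assume k: "k \<in> Z" "k' \<in> Z" "\<phi> k = \<phi> k'"
    show "k = k'"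
    proof
      fix x show "k x = k' x"
        using k \<phi>_coord[of x k] \<phi>_coord[of x k'] h by (cases "x \<in> B") (auto simp: Z_def)
    qed
  qed
  define A where "A = {k \<in> Z. \<phi> k \<in> K}"
  \<comment> \<open>\<open>A\<close> and \<open>H\<close> are the lattice points of \<open>K\<close> and of \<open>K / 2\<close>.\<close>
  define H where "H = {k \<in> Z. 2 *\<^sub>R \<phi> k \<in> K}"
  have zeroK: "0 \<in> K" using ball subspace_0[OF S] by simp
  have mid: "(1/2) *\<^sub>R (a + a') \<in> K" if "a \<in> K" "a' \<in> K" for a a'
    using convexD[OF convex that, of "1/2" "1/2"] by (simp add: scaleR_add_right)
  obtain r where r: "\<And>a. a \<in> K \<Longrightarrow> norm a \<le> r"
    using bounded by (auto simp: bounded_iff)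
  have finA: "finite A"
  proof (rule finite_subset)
    show "A \<subseteq> {k. \<forall>x. (x \<in> B \<longrightarrow> k x \<in> {- \<lceil>r / h\<rceil>..\<lceil>r / h\<rceil>}) \<and> (x \<notin> B \<longrightarrow> k x = 0)}"
    proof safe
      fix k x assume k: "k \<in> A" and x: "x \<in> B"
      have "\<bar>\<phi> k \<bullet> x\<bar> \<le> norm (\<phi> k) * norm x" by (rule Cauchy_Schwarz_ineq2)
      also have "\<dots> \<le> r" using k r nrm[OF x] by (simp add: A_def)
      finally have "\<bar>real_of_int (k x)\<bar> \<le> r / h"
        using h \<phi>_coord[OF x, of k] by (simp add: abs_mult field_simps)
      then show "k x \<in> {- \<lceil>r / h\<rceil>..\<lceil>r / h\<rceil>}" by simp linarith
    qed (auto simp: A_def Z_def)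
    show "finite {k. \<forall>x. (x \<in> B \<longrightarrow> k x \<in> {- \<lceil>r / h\<rceil>..\<lceil>r / h\<rceil>}) \<and> (x \<notin> B \<longrightarrow> k x = (0::int))}"
      by (rule finite_set_of_finite_funs) (use finB in auto)
  qed
  have "H \<subseteq> A"
    using mid[OF _ zeroK] by (force simp: H_def A_def)
  then have finH: "finite H" using finA finite_subset by blast
  have count: "card A \<le> 4 ^ card B * card H"
  proof (rule card_lattice_le_card_dilate[OF finB finA finH])
    fix k k' j assume k: "k \<in> A" "k' \<in> A" and j: "\<And>x. k x - k' x = int 4 * j x"
    have "\<phi> k - \<phi> k' = \<phi> (\<lambda>x. k x + - k' x)"
      unfolding \<phi>_add \<phi>_minus by simp
    also have "\<dots> = 4 *\<^sub>R \<phi> j"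
      using \<phi>_mult[of 4 j] j by simp
    \<comment> \<open>With \<open>\<phi> k\<close> also \<open>- \<phi> k'\<close> lies in \<open>K\<close>, so twice the quotient is the midpoint of two
       points of \<open>K\<close>.\<close>
    finally have "2 *\<^sub>R \<phi> j = (1/2) *\<^sub>R (\<phi> k + - \<phi> k')" by simp
    also have "\<dots> \<in> K" using k sym by (intro mid) (auto simp: A_def)
    moreover have "j x = 0" if "x \<notin> B" for x
      using that k j[of x] by (simp add: A_def Z_def)
    ultimately show "j \<in> H" by (simp add: H_def Z_def)
  qed (auto simp: A_def Z_def)
  have main: "real (card A) * exp (t \<bullet> z - \<epsilon> * norm z) \<le> 4 ^ dim S * (\<Sum>k\<in>A. exp (\<phi> k \<bullet> z))"
    if t: "t \<in> S" "4 *\<^sub>R t \<in> K" for t z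
  proof -
    define k\<^sub>0 where "k\<^sub>0 = (\<lambda>x. if x \<in> B then \<lfloor>(t \<bullet> x) / h\<rfloor> else 0)"
    have k0: "k\<^sub>0 \<in> Z" by (simp add: k\<^sub>0_def Z_def)
    have "\<phi> k\<^sub>0 - t = (\<Sum>b\<in>B. (h * real_of_int (k\<^sub>0 b) - t \<bullet> b) *\<^sub>R b)"
      by (subst expand[OF t(1)]) (simp add: \<phi>_def sum_subtractf scaleR_diff_left)
    also have "norm \<dots> \<le> (\<Sum>b\<in>B. h)"
    proof (rule sum_norm_le)
      fix b assume b: "b \<in> B"
      have "\<bar>real_of_int \<lfloor>(t \<bullet> b) / h\<rfloor> - (t \<bullet> b) / h\<bar> \<le> 1" by linarith
      then have "h * \<bar>real_of_int \<lfloor>(t \<bullet> b) / h\<rfloor> - (t \<bullet> b) / h\<bar> \<le> h" using h by simp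
      moreover have "h * \<bar>real_of_int \<lfloor>(t \<bullet> b) / h\<rfloor> - (t \<bullet> b) / h\<bar> = \<bar>h * real_of_int (k\<^sub>0 b) - t \<bullet> b\<bar>"
        using h b by (subst abs_of_pos[OF h, symmetric], subst abs_mult[symmetric])
          (simp add: k\<^sub>0_def right_diff_distrib)
      ultimately show "norm ((h * real_of_int (k\<^sub>0 b) - t \<bullet> b) *\<^sub>R b) \<le> h"
        using nrm[OF b] by simp
    qed
    also have "\<dots> \<le> min \<epsilon> (\<delta> / 4)" using mesh by simp
    finally have round: "norm (\<phi> k\<^sub>0 - t) \<le> \<epsilon>" "norm (\<phi> k\<^sub>0 - t) \<le> \<delta> / 4" by auto
    have "4 *\<^sub>R (\<phi> k\<^sub>0 - t) \<in> K"
      using round t \<phi>_S by (intro ball(2) subspace_scale subspace_diff S) auto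
    \<comment> \<open>The rounded point still lies in \<open>K / 2\<close>: its double is the midpoint of two points of
       \<open>K\<close>.\<close>
    then have "(1/2) *\<^sub>R (4 *\<^sub>R t + 4 *\<^sub>R (\<phi> k\<^sub>0 - t)) \<in> K"
      using t(2) mid by blast
    then have k0K: "2 *\<^sub>R \<phi> k\<^sub>0 \<in> K"
      by (simp add: scaleR_diff_right)
    have shift: "(\<lambda>x. k\<^sub>0 x + s x) \<in> A" if "s \<in> H" for s
    proof -
      have "(1/2) *\<^sub>R (2 *\<^sub>R \<phi> k\<^sub>0 + 2 *\<^sub>R \<phi> s) \<in> K"
        using that k0K by (intro mid) (auto simp: H_def)
      then show ?thesis
        using that k0 by (simp add: A_def H_def Z_def \<phi>_add scaleR_add_right)
    qed
    have "t \<bullet> z - \<epsilon> * norm z \<le> \<phi> k\<^sub>0 \<bullet> z"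
    proof -
      have "\<bar>(\<phi> k\<^sub>0 - t) \<bullet> z\<bar> \<le> norm (\<phi> k\<^sub>0 - t) * norm z" by (rule Cauchy_Schwarz_ineq2)
      also have "\<dots> \<le> \<epsilon> * norm z" using round by (intro mult_right_mono) auto
      finally show ?thesis by (simp add: inner_diff_left)
    qed
    moreover have "real (card A) \<le> 4 ^ dim S * real (card H)"
      using of_nat_mono[OF count, where ?'a = real] cardB by simp
    ultimately have "real (card A) * exp (t \<bullet> z - \<epsilon> * norm z) \<le> (4 ^ dim S * real (card H)) * exp (\<phi> k\<^sub>0 \<bullet> z)"
      by (intro mult_mono) auto
    also have "\<dots> \<le> 4 ^ dim S * ((\<Sum>s\<in>H. exp (\<phi> s \<bullet> z)) * exp (\<phi> k\<^sub>0 \<bullet> z))"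
    proof -
      have neg: "(\<lambda>x. - s x) \<in> H" if "s \<in> H" for s
        using that sym[of "2 *\<^sub>R \<phi> s"] by (simp add: H_def Z_def \<phi>_minus)
      have "bij_betw (\<lambda>s x. - s x) H H"
        by (rule bij_betw_byWitness[where f' = "\<lambda>s x. - s x"]) (use neg in auto)
      then have "real (card H) \<le> (\<Sum>s\<in>H. exp (\<phi> s \<bullet> z))"
        by (rule card_exp_le_sum_exp_symmetric[OF finH]) (simp add: \<phi>_minus)
      then show ?thesis by (simp add: mult.assoc)
    qed
    also have "(\<Sum>s\<in>H. exp (\<phi> s \<bullet> z)) * exp (\<phi> k\<^sub>0 \<bullet> z)
        = (\<Sum>s\<in>H. exp (\<phi> (\<lambda>x. k\<^sub>0 x + s x) \<bullet> z))"
      unfolding sum_distrib_right \<phi>_add inner_add_left exp_add by (simp only: mult.commute)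
    also have "\<dots> = (\<Sum>k\<in>(\<lambda>s x. k\<^sub>0 x + s x) ` H. exp (\<phi> k \<bullet> z))"
    proof -
      have "inj_on (\<lambda>s x. k\<^sub>0 x + s x) H"
        by (rule inj_onI) (simp add: fun_eq_iff)
      then show ?thesis by (simp only: sum.reindex o_def)
    qed
    also have "\<dots> \<le> (\<Sum>k\<in>A. exp (\<phi> k \<bullet> z))"
      using shift by (intro sum_mono2 finA) auto
    finally show ?thesis by (simp add: mult_left_mono)
  qed
  show thesis
  proof (rule that[of "\<phi> ` A"])
    have "(\<lambda>_. 0) \<in> A" using zeroK by (simp add: A_def Z_def \<phi>_def)
    then show "\<phi> ` A \<noteq> {}" by blast
    have inj: "inj_on \<phi> A" using inj_\<phi> by (rule inj_on_subset) (auto simp: A_def)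
    show "real (card (\<phi> ` A)) * exp (t \<bullet> z - \<epsilon> * norm z) \<le> 4 ^ dim S * (\<Sum>a\<in>\<phi> ` A. exp (a \<bullet> z))"
      if "t \<in> S" "4 *\<^sub>R t \<in> K" for t z
      using main[OF that] by (simp add: card_image[OF inj] sum.reindex[OF inj])
  qed (use finA in \<open>auto simp: A_def\<close>)
qed

section \<open>Orthogonal projections in coordinates\<close>

lemma orth_proj_inner_commute:
  assumes "subspace S"
  shows "orth_proj S x \<bullet> y = x \<bullet> orth_proj S y"
proof -
  have "(y - orth_proj S y) \<bullet> orth_proj S x = 0" "(x - orth_proj S x) \<bullet> orth_proj S y = 0"
    using orth_proj_orthogonal[OF assms] orth_proj_in[OF assms] by (auto simp: orthogonal_def)
  then show ?thesis by (simp add: inner_diff_left inner_diff_right inner_commute)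
qed

lemma inner_orth_proj_right:
  assumes "subspace S" "t \<in> S"
  shows "t \<bullet> orth_proj S x = t \<bullet> x"
  using orth_proj_orthogonal[OF assms, of x]
  by (simp add: orthogonal_def inner_diff_left inner_diff_right inner_commute)

lemma orth_proj_nth:
  fixes S :: "(real ^ 'n) set"
  assumes "subspace S"
  shows "orth_proj S x $ i = orth_proj S (axis i 1) \<bullet> x"
  using orth_proj_inner_commute[OF assms, of x "axis i 1"]
  by (simp add: inner_axis inner_commute)

lemma norm_orth_proj_axis_le_Lambda2: "norm (orth_proj S (axis i 1)) \<le> Lambda2 S"
  unfolding Lambda2_def by (rule Max_ge) auto

text \<open>
  The projection is idempotent and self-adjoint, so its matrix is the Gram matrix of the vectors
  \<open>\<Pi>\<^sub>S e\<^sub>i\<close>. Hence its entries are bounded by the square of \<open>\<Lambda>\<^sub>2(S)\<close>, and not only by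
  \<open>\<Lambda>\<^sub>2(S)\<close>.
\<close>

lemma abs_orth_proj_axis_nth_le:
  assumes S: "subspace S"
  shows "\<bar>orth_proj S (axis i 1) $ j\<bar> \<le> (Lambda2 S)\<^sup>2"
proof -
  have "orth_proj S (axis i 1) $ j = orth_proj S (axis j 1) \<bullet> orth_proj S (axis i 1)"
    using orth_proj_nth[OF S] inner_orth_proj_right[OF S orth_proj_in[OF S]] by metis
  also have "\<bar>\<dots>\<bar> \<le> norm (orth_proj S (axis j 1)) * norm (orth_proj S (axis i 1))"
    by (rule Cauchy_Schwarz_ineq2)
  also have "\<dots> \<le> Lambda2 S * Lambda2 S"
    using norm_orth_proj_axis_le_Lambda2 by (intro mult_mono') auto
  finally show ?thesis by (simp add: power2_eq_square)
qed

lemma infnorm_ge_iff_nth: "infnorm (x :: real ^ 'n) \<ge> u \<longleftrightarrow> (\<exists>i. \<bar>x $ i\<bar> \<ge> u)"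
  by (auto simp: infnorm_Max Max_ge_iff Basis_vec_def inner_axis)

lemma convex_norm_infnorm_le:
  fixes S :: "'a::euclidean_space set"
  assumes "subspace S"
  shows "convex {t \<in> S. norm t \<le> r \<and> infnorm t \<le> b}"
proof (rule convexI, safe)
  fix x y :: 'a and p q :: real
  assume x: "x \<in> S" "norm x \<le> r" "infnorm x \<le> b" and y: "y \<in> S" "norm y \<le> r" "infnorm y \<le> b"
    and pq: "0 \<le> p" "0 \<le> q" "p + q = 1"
  show "p *\<^sub>R x + q *\<^sub>R y \<in> S"
    using assms x y by (simp add: subspace_add subspace_scale)
  show "norm (p *\<^sub>R x + q *\<^sub>R y) \<le> r"
    using x y pq by (intro norm_triangle_le order_trans[OF _ convex_bound_le[OF x(2) y(2) pq]]) auto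
  have "infnorm (p *\<^sub>R x + q *\<^sub>R y) \<le> p * infnorm x + q * infnorm y"
    using infnorm_triangle[of "p *\<^sub>R x" "q *\<^sub>R y"] pq by (simp add: infnorm_mul)
  also have "\<dots> \<le> b" by (rule convex_bound_le) (use x y pq in auto)
  finally show "infnorm (p *\<^sub>R x + q *\<^sub>R y) \<le> b" .
qed

section \<open>Sub-gamma random variables\<close>

context prob_space
begin

text \<open>
  The Bernstein moment condition, known as sub-gamma tails on both sides with variance factor \<open>v\<close>
  and scale \<open>c\<close>. Writing the range of \<open>l\<close> as \<open>\<bar>l\<bar> * c < 1\<close> builds in the convention
  \<open>1 / 0 = \<infinity>\<close>, and bounding the expectation instead of its logarithm lets the bounds be multiplied
  for independent variables.
\<close>

definition sub_gamma :: "real \<Rightarrow> real \<Rightarrow> ('a \<Rightarrow> real) \<Rightarrow> bool" where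
  "sub_gamma v c X \<longleftrightarrow> (\<forall>l. \<bar>l\<bar> * c < 1 \<longrightarrow>
     integrable M (\<lambda>\<omega>. exp (l * X \<omega>)) \<and>
     expectation (\<lambda>\<omega>. exp (l * X \<omega>)) \<le> exp (l\<^sup>2 * v / (2 * (1 - \<bar>l\<bar> * c))))"

lemma sub_gammaD:
  assumes "sub_gamma v c X" "\<bar>l\<bar> * c < 1"
  shows "integrable M (\<lambda>\<omega>. exp (l * X \<omega>))"
    and "expectation (\<lambda>\<omega>. exp (l * X \<omega>)) \<le> exp (l\<^sup>2 * v / (2 * (1 - \<bar>l\<bar> * c)))"
  using assms by (auto simp: sub_gamma_def)

lemma sub_gamma_mono:
  assumes "sub_gamma v c X" "v \<le> w"
  shows "sub_gamma w c X"
  unfolding sub_gamma_def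
proof (intro allI impI conjI)
  fix l assume l: "\<bar>l\<bar> * c < 1"
  note sub_gammaD(2)[OF assms(1) l]
  also have "exp (l\<^sup>2 * v / (2 * (1 - \<bar>l\<bar> * c))) \<le> exp (l\<^sup>2 * w / (2 * (1 - \<bar>l\<bar> * c)))"
    using l assms(2) by (simp add: divide_right_mono mult_left_mono)
  finally show "expectation (\<lambda>\<omega>. exp (l * X \<omega>)) \<le> exp (l\<^sup>2 * w / (2 * (1 - \<bar>l\<bar> * c)))" .
qed (use sub_gammaD[OF assms(1)] in auto)

lemma sub_gamma_uminus:
  assumes "sub_gamma v c X"
  shows "sub_gamma v c (\<lambda>\<omega>. - X \<omega>)"
  unfolding sub_gamma_def
proof (intro allI impI)
  fix l :: real assume l: "\<bar>l\<bar> * c < 1"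
  then show "integrable M (\<lambda>\<omega>. exp (l * - X \<omega>)) \<and>
     expectation (\<lambda>\<omega>. exp (l * - X \<omega>)) \<le> exp (l\<^sup>2 * v / (2 * (1 - \<bar>l\<bar> * c)))"
    using sub_gammaD[OF assms, of "- l"] by simp
qed

text \<open>
  Markov's inequality for \<open>exp (l * X)\<close> with \<open>l = x / (v + c x)\<close>. This choice gives
  \<open>1 - l c = v / (v + c x)\<close>, which simplifies the exponent; it is positive only when \<open>v\<close> is.
\<close>

lemma sub_gamma_tail_pos_variance:
  assumes X: "sub_gamma v c X" and v: "v > 0" and c: "c \<ge> 0" and x: "x > 0"
  shows "\<P>(\<omega> in M. X \<omega> \<ge> x) \<le> exp (- (x\<^sup>2 / (2 * (v + c * x))))"
proof -
  define w where "w = v + c * x"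
  have w: "w > 0" using v c x by (simp add: w_def add_pos_nonneg)
  define l where "l = x / w"
  have l: "l > 0" using x w by (simp add: l_def)
  have lc: "1 - \<bar>l\<bar> * c = v / w"
    using w l by (simp add: l_def field_simps) (simp add: w_def algebra_simps)
  have "v / w > 0" using v w by simp
  then have dom: "\<bar>l\<bar> * c < 1" using lc by linarith
  have eq: "l\<^sup>2 * v / (2 * (1 - \<bar>l\<bar> * c)) = x\<^sup>2 / (2 * w)"
    unfolding lc using v w by (simp add: l_def field_simps power2_eq_square)
  have eq2: "l * x = x\<^sup>2 / w"
    by (simp add: l_def power2_eq_square)
  have "\<P>(\<omega> in M. X \<omega> \<ge> x) = \<P>(\<omega> in M. exp (l * X \<omega>) \<ge> exp (l * x))"
    using l by simp
  also have "\<dots> \<le> expectation (\<lambda>\<omega>. exp (l * X \<omega>)) / exp (l * x)"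
    by (rule integral_Markov_inequality_measure[OF sub_gammaD(1)[OF X dom] sets.top]) auto
  also have "\<dots> \<le> exp (x\<^sup>2 / (2 * w)) / exp (x\<^sup>2 / w)"
    unfolding eq2 using sub_gammaD(2)[OF X dom, unfolded eq] by (rule divide_right_mono) simp
  also have "\<dots> = exp (- (x\<^sup>2 / (2 * w)))"
    unfolding exp_diff[symmetric] by (simp add: field_simps)
  finally show ?thesis by (simp add: w_def)
qed

text \<open>
  A variable with variance factor \<open>v\<close> has every larger variance factor as well, and the bound for
  positive variance factors is continuous as they decrease to \<open>v\<close>. This also covers \<open>v = 0\<close>, and
  for \<open>v = c = 0\<close> the limit is the value 0 that \<open>exp_neg_div\<close> assigns to a zero denominator.
\<close>

lemma sub_gamma_tail:
  assumes X: "sub_gamma v c X" and v: "v \<ge> 0" and c: "c \<ge> 0" and x: "x > 0"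
  shows "\<P>(\<omega> in M. X \<omega> \<ge> x) \<le> exp_neg_div (x\<^sup>2) (2 * (v + c * x))"
proof -
  have "\<P>(\<omega> in M. X \<omega> \<ge> x) \<le> exp (- (x\<^sup>2 / (2 * (w + c * x))))" if "w > v" for w
    using sub_gamma_tail_pos_variance[OF sub_gamma_mono[OF X] _ c x] that v by simp
  then have ev: "eventually (\<lambda>w. \<P>(\<omega> in M. X \<omega> \<ge> x) \<le> exp (- (x\<^sup>2 / (2 * (w + c * x))))) (at_right v)"
    by (intro eventually_at_right_less[THEN eventually_mono])
  have "((\<lambda>w. exp (- (x\<^sup>2 / (2 * (w + c * x))))) \<longlongrightarrow> exp_neg_div (x\<^sup>2) (2 * (v + c * x))) (at_right v)"
  proof (cases "v + c * x = 0")
    case True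
    then have "v = 0" "c = 0" using v c x by (auto simp: add_nonneg_eq_0_iff)
    moreover have "((\<lambda>w. exp (- (x\<^sup>2 / (2 * w)))) \<longlongrightarrow> 0) (at_right 0)"
    proof (rule filterlim_compose[OF exp_at_bot])
      have "filterlim (\<lambda>w. x\<^sup>2 / 2 * inverse w) at_top (at_right 0)"
        using x by (intro filterlim_tendsto_pos_mult_at_top[OF tendsto_const _ filterlim_inverse_at_top_right]) auto
      moreover have "x\<^sup>2 / 2 * inverse w = x\<^sup>2 / (2 * w)" for w
        by (simp add: divide_simps)
      ultimately show "filterlim (\<lambda>w. - (x\<^sup>2 / (2 * w))) at_bot (at_right 0)"
        by (simp only: filterlim_uminus_at_top)
    qed
    ultimately show ?thesis by (simp add: exp_neg_div_def)
  next
    case False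
    then show ?thesis
      unfolding exp_neg_div_def by (auto intro!: tendsto_eq_intros)
  qed
  then show ?thesis
    by (rule tendsto_lowerbound[OF _ ev]) simp
qed

text \<open>
  The exponential moment of \<open>t \<bullet> \<xi>\<close> is the product of those of the components at \<open>l t\<^sub>i\<close>. In all
  factors the denominator is bounded below with the largest \<open>\<bar>t\<^sub>i\<bar>\<close>; the numerators add up to the
  squared Euclidean norm.
\<close>

lemma sub_gamma_inner:
  fixes \<xi> :: "'a \<Rightarrow> real ^ 'n"
  assumes indep: "indep_vars (\<lambda>_. borel) (\<lambda>i \<omega>. \<xi> \<omega> $ i) UNIV"
    and \<xi>: "\<And>i. sub_gamma v c (\<lambda>\<omega>. \<xi> \<omega> $ i)"
    and v: "v \<ge> 0" and c: "c \<ge> 0" and t: "\<And>i. \<bar>t $ i\<bar> \<le> m"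
  shows "sub_gamma ((norm t)\<^sup>2 * v) (m * c) (\<lambda>\<omega>. t \<bullet> \<xi> \<omega>)"
  unfolding sub_gamma_def
proof (intro allI impI)
  fix l :: real assume l: "\<bar>l\<bar> * (m * c) < 1"
  have dom: "\<bar>l * t $ i\<bar> * c \<le> \<bar>l\<bar> * (m * c)" for i
    using t[of i] c by (simp add: abs_mult mult.assoc mult_left_mono mult_right_mono)
  have dom1: "\<bar>l * t $ i\<bar> * c < 1" for i
    using dom[of i] l by linarith
  note comp = sub_gammaD[OF \<xi> dom1]
  have prod: "exp (l * (t \<bullet> \<xi> \<omega>)) = (\<Prod>i\<in>UNIV. exp (l * t $ i * \<xi> \<omega> $ i))" for \<omega>
    by (simp add: inner_vec_def sum_distrib_left exp_sum mult.assoc)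
  have ind: "indep_vars (\<lambda>_. borel) (\<lambda>i \<omega>. exp (l * t $ i * \<xi> \<omega> $ i)) UNIV"
    using indep_vars_compose2[OF indep, of "\<lambda>i y. exp (l * t $ i * y)" "\<lambda>_. borel"] by simp
  have "expectation (\<lambda>\<omega>. exp (l * (t \<bullet> \<xi> \<omega>))) = (\<Prod>i\<in>UNIV. expectation (\<lambda>\<omega>. exp (l * t $ i * \<xi> \<omega> $ i)))"
    unfolding prod using comp(1) by (intro indep_vars_lebesgue_integral ind) auto
  also have "\<dots> \<le> (\<Prod>i\<in>UNIV. exp ((l * t $ i)\<^sup>2 * v / (2 * (1 - \<bar>l\<bar> * (m * c)))))"
  proof (intro prod_mono conjI)
    fix i
    have "expectation (\<lambda>\<omega>. exp (l * t $ i * \<xi> \<omega> $ i)) \<le> exp ((l * t $ i)\<^sup>2 * v / (2 * (1 - \<bar>l * t $ i\<bar> * c)))"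
      by (rule comp(2))
    also have "\<dots> \<le> exp ((l * t $ i)\<^sup>2 * v / (2 * (1 - \<bar>l\<bar> * (m * c))))"
      unfolding exp_le_cancel_iff using v l dom[of i] by (intro divide_left_mono mult_pos_pos) auto
    finally show "expectation (\<lambda>\<omega>. exp (l * t $ i * \<xi> \<omega> $ i)) \<le> exp ((l * t $ i)\<^sup>2 * v / (2 * (1 - \<bar>l\<bar> * (m * c))))" .
  qed simp
  also have "\<dots> = exp (l\<^sup>2 * ((norm t)\<^sup>2 * v) / (2 * (1 - \<bar>l\<bar> * (m * c))))"
  proof -
    have "(norm t)\<^sup>2 = (\<Sum>i\<in>UNIV. (t $ i)\<^sup>2)"
      unfolding power2_norm_eq_inner inner_vec_def by (simp add: power2_eq_square)
    then show ?thesis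
      by (simp add: exp_sum[symmetric] sum_divide_distrib sum_distrib_left sum_distrib_right
          power_mult_distrib mult.assoc)
  qed
  finally have bound: "expectation (\<lambda>\<omega>. exp (l * (t \<bullet> \<xi> \<omega>))) \<le> \<dots>" .
  moreover have "integrable M (\<lambda>\<omega>. exp (l * (t \<bullet> \<xi> \<omega>)))"
    unfolding prod using comp(1) by (intro indep_vars_integrable ind) auto
  ultimately show "integrable M (\<lambda>\<omega>. exp (l * (t \<bullet> \<xi> \<omega>))) \<and>
      expectation (\<lambda>\<omega>. exp (l * (t \<bullet> \<xi> \<omega>))) \<le> exp (l\<^sup>2 * ((norm t)\<^sup>2 * v) / (2 * (1 - \<bar>l\<bar> * (m * c))))"
    by blast
qed

section \<open>The two tail bounds\<close>

lemma infnorm_orth_proj_tail: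
  fixes \<xi> :: "'a \<Rightarrow> real ^ 'n"
  assumes S: "subspace S"
    and indep: "indep_vars (\<lambda>_. borel) (\<lambda>i \<omega>. \<xi> \<omega> $ i) UNIV"
    and \<xi>: "\<And>i. sub_gamma v c (\<lambda>\<omega>. \<xi> \<omega> $ i)"
    and v: "v \<ge> 0" and c: "c \<ge> 0" and x: "x > 0"
  shows "\<P>(\<omega> in M. infnorm (orth_proj S (\<xi> \<omega>)) \<ge> x)
    \<le> 2 * real CARD('n) * exp_neg_div (x\<^sup>2) (2 * (Lambda2 S)\<^sup>2 * (v + c * x))"
proof -
  define p where "p i = orth_proj S (axis i 1)" for i :: 'n
  define L where "L = (Lambda2 S)\<^sup>2"
  have [measurable]: "(\<lambda>\<omega>. \<xi> \<omega> $ i) \<in> borel_measurable M" for i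
    using indep by (auto simp: indep_vars_def)
  have [measurable]: "(\<lambda>\<omega>. p i \<bullet> \<xi> \<omega>) \<in> borel_measurable M" for i
    by (simp add: inner_vec_def)
  have L: "L \<ge> 0" by (simp add: L_def)
  have pL: "(norm (p i))\<^sup>2 \<le> L" for i
    unfolding L_def p_def using norm_orth_proj_axis_le_Lambda2 by (intro power_mono) auto
  have sg: "sub_gamma (L * v) (L * c) (\<lambda>\<omega>. p i \<bullet> \<xi> \<omega>)" for i
  proof (rule sub_gamma_mono)
    show "sub_gamma ((norm (p i))\<^sup>2 * v) (L * c) (\<lambda>\<omega>. p i \<bullet> \<xi> \<omega>)"
      using abs_orth_proj_axis_nth_le[OF S] by (intro sub_gamma_inner indep \<xi> v c) (simp add: p_def L_def)
  qed (use pL v in \<open>auto intro: mult_right_mono\<close>)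
  define e where "e = exp_neg_div (x\<^sup>2) (2 * L * (v + c * x))"
  have eq: "2 * (L * v + L * c * x) = 2 * L * (v + c * x)" by (simp add: algebra_simps)
  have up: "\<P>(\<omega> in M. p i \<bullet> \<xi> \<omega> \<ge> x) \<le> e" for i
    using sub_gamma_tail[OF sg _ _ x, of i] L v c unfolding eq e_def by simp
  have down: "\<P>(\<omega> in M. - (p i \<bullet> \<xi> \<omega>) \<ge> x) \<le> e" for i
    using sub_gamma_tail[OF sub_gamma_uminus[OF sg] _ _ x, of i] L v c unfolding eq e_def by simp
  define E where "E i = {\<omega> \<in> space M. p i \<bullet> \<xi> \<omega> \<ge> x} \<union> {\<omega> \<in> space M. - (p i \<bullet> \<xi> \<omega>) \<ge> x}" for i
  have E: "E i \<in> events" for i unfolding E_def by measurable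
  have E_le: "prob (E i) \<le> 2 * e" for i
  proof -
    have "prob (E i) \<le> \<P>(\<omega> in M. p i \<bullet> \<xi> \<omega> \<ge> x) + \<P>(\<omega> in M. - (p i \<bullet> \<xi> \<omega>) \<ge> x)"
      unfolding E_def by (rule measure_Un_le) measurable
    then show ?thesis using up[of i] down[of i] by linarith
  qed
  have "{\<omega> \<in> space M. infnorm (orth_proj S (\<xi> \<omega>)) \<ge> x} \<subseteq> (\<Union>i. E i)"
  proof
    fix \<omega> assume \<omega>: "\<omega> \<in> {\<omega> \<in> space M. infnorm (orth_proj S (\<xi> \<omega>)) \<ge> x}"
    then obtain i where "\<bar>orth_proj S (\<xi> \<omega>) $ i\<bar> \<ge> x"
      by (auto simp: infnorm_ge_iff_nth)
    then show "\<omega> \<in> (\<Union>i. E i)"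
      using \<omega> orth_proj_nth[OF S, of "\<xi> \<omega>" i] by (auto simp: E_def p_def abs_if split: if_splits)
  qed
  then have "\<P>(\<omega> in M. infnorm (orth_proj S (\<xi> \<omega>)) \<ge> x) \<le> prob (\<Union>i. E i)"
    using E by (intro finite_measure_mono) auto
  also have "\<dots> \<le> (\<Sum>i\<in>UNIV. prob (E i))"
    using E by (intro finite_measure_subadditive_finite) auto
  also have "\<dots> \<le> (\<Sum>i\<in>(UNIV::'n set). 2 * e)"
    by (rule sum_mono) (rule E_le)
  finally show ?thesis by (simp add: e_def L_def)
qed

text \<open>
  Let \<open>y = D + x\<close>, \<open>q = 18 v + 2 c u\<close>, and let \<open>R = sqrt (18 q y)\<close> be the threshold for the norm.
  The body \<open>K\<close> has Euclidean radius \<open>r = R / q\<close>. A vector of norm at least \<open>R\<close> and sup norm at most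
  \<open>u\<close>, rescaled to norm \<open>r\<close>, has sup norm at most \<open>r u / R = u / q = b\<close>, which dictates the sup
  norm bound of \<open>K\<close>. Then \<open>b c \<le> 1/2\<close> and \<open>r\<^sup>2 v \<le> y\<close>, so exponential moments over \<open>K\<close> are at most
  \<open>exp y\<close>. On the event the lattice average is at least \<open>exp (4 y) / 4 ^ D\<close>, since \<open>r R = 18 y\<close>. The
  probability is thus at most \<open>4 ^ D exp (- 3 y)\<close>, and \<open>4 \<le> exp 2\<close>.
\<close>

lemma norm_orth_proj_tail_on_infnorm_le:
  fixes \<xi> :: "'a \<Rightarrow> real ^ 'n"
  assumes S: "subspace S"
    and indep: "indep_vars (\<lambda>_. borel) (\<lambda>i \<omega>. \<xi> \<omega> $ i) UNIV"
    and \<xi>: "\<And>i. sub_gamma v c (\<lambda>\<omega>. \<xi> \<omega> $ i)"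
    and v: "v \<ge> 0" and c: "c \<ge> 0" and vc: "v \<noteq> 0 \<or> c \<noteq> 0" and x: "x > 0" and u: "u > 0"
  shows "\<P>(\<omega> in M. (norm (orth_proj S (\<xi> \<omega>)))\<^sup>2 \<ge> 18 * (18 * v + 2 * c * u) * (real (dim S) + x)
      \<and> infnorm (orth_proj S (\<xi> \<omega>)) \<le> u) \<le> exp (- x)"
proof -
  define y where "y = real (dim S) + x"
  define q where "q = 18 * v + 2 * c * u"
  define R where "R = sqrt (18 * q * y)"
  define r where "r = R / q"
  define b where "b = u / q"
  have y: "y > 0" using x by (simp add: y_def add_nonneg_pos)
  have q: "q > 0"
    using v c vc u by (auto simp: q_def intro: add_pos_nonneg add_nonneg_pos)
  have R: "R > 0" "R\<^sup>2 = 18 * q * y" using q y by (simp_all add: R_def)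
  have r: "r > 0" and b: "b > 0" using R q u by (simp_all add: r_def b_def)
  have rR: "r * R = 18 * y"
    using R q by (simp add: r_def power2_eq_square field_simps)
  have bc: "b * c \<le> 1 / 2"
    using q v by (simp add: b_def field_simps) (simp add: q_def)
  have rv: "r\<^sup>2 * v \<le> y"
  proof -
    have "r\<^sup>2 * v = 18 * y * v / q"
      using R q by (simp add: r_def power_divide) (simp add: power2_eq_square field_simps)
    also have "\<dots> \<le> y"
    proof -
      have "18 * v \<le> q" using c u by (simp add: q_def)
      then have "18 * v * y \<le> q * y" using y by simp
      then show ?thesis using q by (simp add: field_simps)
    qed
    finally show ?thesis .
  qed
  define K where "K = {t \<in> S. norm t \<le> r \<and> infnorm t \<le> b}"
  \<comment> \<open>The rounding allowance \<open>r / 36\<close> leaves \<open>r / 4 - r / 36 = 2 r / 9\<close>, and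
     \<open>(2 / 9) r R = 4 y\<close>.\<close>
  obtain A where A: "finite A" "A \<noteq> {}" "A \<subseteq> K"
    and dom: "\<And>t z. t \<in> S \<Longrightarrow> 4 *\<^sub>R t \<in> K \<Longrightarrow>
       real (card A) * exp (t \<bullet> z - r / 36 * norm z) \<le> 4 ^ dim S * (\<Sum>a\<in>A. exp (a \<bullet> z))"
  proof (rule exp_inner_le_lattice_average[OF S, of K "min r b" "r / 36"])
    show "convex K" unfolding K_def by (rule convex_norm_infnorm_le[OF S])
    show "bounded K" by (rule boundedI[of _ r]) (simp add: K_def)
    show "- a \<in> K" if "a \<in> K" for a
      using that S by (simp add: K_def subspace_neg infnorm_neg)
    show "a \<in> K" if "a \<in> S" "norm a \<le> min r b" for a
      using that infnorm_le_norm[of a] by (simp add: K_def)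
  qed (use r b in \<open>auto simp: K_def\<close>)
  have mgf: "integrable M (\<lambda>\<omega>. exp (a \<bullet> \<xi> \<omega>))" "expectation (\<lambda>\<omega>. exp (a \<bullet> \<xi> \<omega>)) \<le> exp y"
    if "a \<in> A" for a
  proof -
    have a: "norm a \<le> r" "infnorm a \<le> b" using that A by (auto simp: K_def)
    have "\<bar>a $ i\<bar> \<le> b" for i
      using component_le_infnorm_cart[of a i] a by linarith
    then have sg: "sub_gamma ((norm a)\<^sup>2 * v) (b * c) (\<lambda>\<omega>. a \<bullet> \<xi> \<omega>)"
      by (intro sub_gamma_inner indep \<xi> v c)
    have 1: "\<bar>1\<bar> * (b * c) < 1" using bc by simp
    show "integrable M (\<lambda>\<omega>. exp (a \<bullet> \<xi> \<omega>))"
      using sub_gammaD(1)[OF sg 1] by simp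
    have "expectation (\<lambda>\<omega>. exp (a \<bullet> \<xi> \<omega>)) \<le> exp ((norm a)\<^sup>2 * v / (2 * (1 - b * c)))"
      using sub_gammaD(2)[OF sg 1] by simp
    also have "(norm a)\<^sup>2 * v / (2 * (1 - b * c)) \<le> (norm a)\<^sup>2 * v / 1"
      using bc v by (intro divide_left_mono) auto
    also have "\<dots> \<le> r\<^sup>2 * v"
      using a v by (simp add: mult_right_mono power_mono)
    finally show "expectation (\<lambda>\<omega>. exp (a \<bullet> \<xi> \<omega>)) \<le> exp y"
      using rv by (simp add: order_trans)
  qed
  define F where "F \<omega> = (\<Sum>a\<in>A. exp (a \<bullet> \<xi> \<omega>))" for \<omega>
  define C where "C = real (card A) * exp (4 * y) / 4 ^ dim S"
  have cardA: "real (card A) > 0" using A by (simp add: card_gt_0_iff)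
  then have C: "C > 0" by (simp add: C_def)
  have F_int: "integrable M F"
    unfolding F_def using mgf by (intro Bochner_Integration.integrable_sum) auto
  have F_exp: "expectation F \<le> real (card A) * exp y"
  proof -
    have "expectation F = (\<Sum>a\<in>A. expectation (\<lambda>\<omega>. exp (a \<bullet> \<xi> \<omega>)))"
      unfolding F_def using mgf by (intro Bochner_Integration.integral_sum) auto
    also have "\<dots> \<le> (\<Sum>a\<in>A. exp y)" by (rule sum_mono) (rule mgf)
    finally show ?thesis by simp
  qed
  have F_large: "F \<omega> \<ge> C"
    if norm2: "(norm (orth_proj S (\<xi> \<omega>)))\<^sup>2 \<ge> 18 * q * y" and inf: "infnorm (orth_proj S (\<xi> \<omega>)) \<le> u" for \<omega>
  proof -
    define z where "z = orth_proj S (\<xi> \<omega>)"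
    have z: "norm z \<ge> R"
    proof (rule power2_le_imp_le)
      show "R\<^sup>2 \<le> (norm z)\<^sup>2" using norm2 unfolding R(2) z_def .
    qed simp
    have zS: "z \<in> S" unfolding z_def by (rule orth_proj_in[OF S])
    define t where "t = (r / (4 * norm z)) *\<^sub>R z"
    have norm_z: "norm z > 0" using z R by linarith
    have tS: "t \<in> S" unfolding t_def by (rule subspace_scale[OF S zS])
    have four_t: "4 *\<^sub>R t = (r / norm z) *\<^sub>R z" by (simp add: t_def)
    have "4 *\<^sub>R t \<in> K"
    proof -
      have "infnorm (4 *\<^sub>R t) = r / norm z * infnorm z"
        unfolding four_t using r by (simp add: infnorm_mul)
      also have "\<dots> \<le> r / R * u"
      proof (rule mult_mono)
        show "r / norm z \<le> r / R" using z R r norm_z by (intro divide_left_mono) auto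
        show "infnorm z \<le> u" using inf by (simp add: z_def)
      qed (use R r infnorm_pos_le in auto)
      also have "\<dots> = b" using R by (simp add: r_def b_def)
      finally have "infnorm (4 *\<^sub>R t) \<le> b" .
      moreover have "norm (4 *\<^sub>R t) = r" unfolding four_t using norm_z r by simp
      moreover have "4 *\<^sub>R t \<in> S" by (rule subspace_scale[OF S tS])
      ultimately show ?thesis by (simp add: K_def)
    qed
    have tz: "t \<bullet> z = r / 4 * norm z"
      using norm_z by (simp add: t_def dot_square_norm power2_eq_square)
    have "r * R \<le> r * norm z" using z r by simp
    then have "4 * y \<le> t \<bullet> z - r / 36 * norm z"
      using tz rR by simp
    then have "real (card A) * exp (4 * y) \<le> real (card A) * exp (t \<bullet> z - r / 36 * norm z)"
      by (simp add: mult_left_mono)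
    also have "\<dots> \<le> 4 ^ dim S * (\<Sum>a\<in>A. exp (a \<bullet> z))"
      by (rule dom) fact+
    also have "(\<Sum>a\<in>A. exp (a \<bullet> z)) = F \<omega>"
      unfolding F_def z_def using A by (intro sum.cong) (auto simp: K_def inner_orth_proj_right[OF S])
    finally show ?thesis by (simp add: C_def field_simps)
  qed
  have "\<P>(\<omega> in M. (norm (orth_proj S (\<xi> \<omega>)))\<^sup>2 \<ge> 18 * q * y \<and> infnorm (orth_proj S (\<xi> \<omega>)) \<le> u)
      \<le> \<P>(\<omega> in M. F \<omega> \<ge> C)"
    using F_large F_int by (intro finite_measure_mono) auto
  also have "\<dots> \<le> expectation F / C"
    by (rule integral_Markov_inequality_measure[OF F_int sets.top _ C]) (auto simp: F_def sum_nonneg)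
  also have "\<dots> \<le> real (card A) * exp y / C"
    using F_exp C by (simp add: divide_right_mono)
  also have "\<dots> = 4 ^ dim S * exp (- (3 * y))"
    using cardA exp_add[of y "3 * y"] by (simp add: C_def exp_minus field_simps)
  also have "\<dots> \<le> exp (2 * real (dim S)) * exp (- (3 * y))"
  proof -
    have "(2::real) \<le> exp 1" using exp_ge_add_one_self[of 1] by simp
    then have "2 * 2 \<le> exp 1 * exp (1::real)" by (intro mult_mono) auto
    then have "4 \<le> exp (2::real)" by (simp flip: exp_add)
    then have "4 ^ dim S \<le> exp (2::real) ^ dim S" by (intro power_mono) auto
    then show ?thesis by (simp add: exp_of_nat_mult[symmetric] mult.commute)
  qed
  also have "\<dots> \<le> exp (- x)"
    using x unfolding exp_add[symmetric] by (simp add: y_def)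
  finally show ?thesis by (simp add: q_def y_def)
qed

end

theorem theorem5:
  fixes M :: "'w measure"
    and \<xi> :: "'w \<Rightarrow> real ^ 'n"
    and S :: "(real ^ 'n) set"
    and D :: nat
    and \<sigma> c \<kappa> :: real
  assumes "CARD('n) \<ge> 2"
    and "subspace S" and "dim S = D"
    and "prob_space M"
    and "prob_space.indep_vars M (\<lambda>_. borel) (\<lambda>i \<omega>. \<xi> \<omega> $ i) UNIV"
    and "\<And>i. integrable M (\<lambda>\<omega>. \<xi> \<omega> $ i)"
    and "\<And>i. prob_space.expectation M (\<lambda>\<omega>. \<xi> \<omega> $ i) = 0"
    and "\<sigma> \<ge> 0" and "c \<ge> 0"
    and "\<And>l i. c = 0 \<or> l \<in> {- 1 / c<..<1 / c} \<Longrightarrow>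
           integrable M (\<lambda>\<omega>. exp (l * \<xi> \<omega> $ i)) \<and>
           ln (prob_space.expectation M (\<lambda>\<omega>. exp (l * \<xi> \<omega> $ i)))
             \<le> l\<^sup>2 * \<sigma>\<^sup>2 / (2 * (1 - \<bar>l\<bar> * c))"
    and "\<kappa> = 18"
  shows "(\<sigma> \<noteq> 0 \<or> c \<noteq> 0 \<longrightarrow>
           (\<forall>x>0. \<forall>u>0.
             \<P>(\<omega> in M. (norm (orth_proj S (\<xi> \<omega>)))\<^sup>2
                         \<ge> \<kappa>\<^sup>2 * (\<sigma>\<^sup>2 + 2 * c * u / \<kappa>) * (real D + x)
                     \<and> infnorm (orth_proj S (\<xi> \<omega>)) \<le> u)
               \<le> exp (- x)))
       \<and> (\<forall>x>0.
             \<P>(\<omega> in M. infnorm (orth_proj S (\<xi> \<omega>)) \<ge> x)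
               \<le> 2 * real CARD('n) * exp_neg_div (x\<^sup>2) (2 * (Lambda2 S)\<^sup>2 * (\<sigma>\<^sup>2 + c * x)))"
proof -
  interpret prob_space M by fact
  note S = assms(2) and dimS = assms(3) and indep = assms(5) and c = assms(9) and log_mgf = assms(10)
  have \<xi>: "sub_gamma (\<sigma>\<^sup>2) c (\<lambda>\<omega>. \<xi> \<omega> $ i)" for i
    unfolding sub_gamma_def
  proof (intro allI impI)
    fix l :: real assume l: "\<bar>l\<bar> * c < 1"
    have "c = 0 \<or> l \<in> {- 1 / c<..<1 / c}"
    proof (cases "c = 0")
      case False
      then have "\<bar>l\<bar> < 1 / c" using l c by (simp add: pos_less_divide_eq)
      then show ?thesis by (auto simp: abs_less_iff)
    qed simp
    note h = log_mgf[OF this, of i]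
    \<comment> \<open>The bound on the logarithm carries over to the expectation if that is positive; otherwise
       the claim is trivial.\<close>
    have "expectation (\<lambda>\<omega>. exp (l * \<xi> \<omega> $ i)) \<le> exp (l\<^sup>2 * \<sigma>\<^sup>2 / (2 * (1 - \<bar>l\<bar> * c)))"
    proof (cases "expectation (\<lambda>\<omega>. exp (l * \<xi> \<omega> $ i)) > 0")
      case True
      then show ?thesis using h by (metis exp_le_cancel_iff exp_ln)
    next
      case False
      then show ?thesis by (meson exp_ge_zero not_less order_trans)
    qed
    then show "integrable M (\<lambda>\<omega>. exp (l * \<xi> \<omega> $ i)) \<and>
        expectation (\<lambda>\<omega>. exp (l * \<xi> \<omega> $ i)) \<le> exp (l\<^sup>2 * \<sigma>\<^sup>2 / (2 * (1 - \<bar>l\<bar> * c)))"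
      using h by blast
  qed
  have threshold: "\<kappa>\<^sup>2 * (\<sigma>\<^sup>2 + 2 * c * u / \<kappa>) * (real D + x)
      = 18 * (18 * \<sigma>\<^sup>2 + 2 * c * u) * (real (dim S) + x)" for u x
    unfolding \<open>\<kappa> = 18\<close> dimS by (simp add: power2_eq_square algebra_simps)
  show ?thesis
    unfolding threshold
    using norm_orth_proj_tail_on_infnorm_le[OF S indep \<xi> _ c]
      infnorm_orth_proj_tail[OF S indep \<xi> _ c] by auto
qed

end
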